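(* Let $\Omega$ be a finite set with $|\Omega|=n$, let $L$ be the generator of an irreducible continuous-time Markov process on $\Omega$ which is reversible with respect to a positive measure $\mu$ on $\Omega$, and let $\{u_1,\dots,u_n\}$ be an orthonormal basis of the real space $L^2(\mu)$ consisting of eigenfunctions of $L$, with $Lu_i=\lambda_i u_i$, $0=\lambda_1>\lambda_2\ge\dots\ge\lambda_n$, and $u_1$ constant. Then: (i) For all $a_1,\dots,a_n\in\mathbb{R}$, the function $D(x,y)=\sum_{i=1}^n a_i u_i(x)u_i(y)$ is a self-duality function for $L$. (ii) Every self-duality function $D$ for $L$ has a unique decomposition of the form $D(x,y)=\sum_{i,j:\lambda_i=\lambda_j} a_{ij}\,u_i(x)u_j(y)$ with real coefficients $a_{ij}$. (iii) If a function of the form $D(x,y)=f(x)g(y)$, with $f,g:\Omega\to\mathbb{R}$, is a non-zero self-duality function for $L$, then $f$ and $g$ are eigenfunctions of $L$ corresponding to the same eigenvalue. (iv) If $D$ and $D'$ are self-duality functions for $L$, then $D''(x,x'):=\langle D(x,\cdot),D'(x',\cdot)\rangle_\mu$ defines a self-duality function $D''$ for $L$.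
   Context: A generator $L$ on a finite set $\Omega$ is identified with a real matrix $L(x,y)$, $x,y\in\Omega$, with $L(x,y)\ge 0$ for $x\ne y$ and $\sum_{y}L(x,y)=0$, acting on functions by $Lf(x)=\sum_y L(x,y)f(y)$. Reversibility with respect to $\mu$ means $\mu(x)L(x,y)=\mu(y)L(y,x)$ for all $x,y\in\Omega$. The inner product is $\langle f,g\rangle_\mu=\sum_{x\in\Omega}f(x)g(x)\mu(x)$. A function $D:\Omega\times\Omega\to\mathbb{R}$ is a self-duality function for $L$ if $L$ acting on the first variable of $D$ equals $L$ acting on the second variable: for all $x,y\in\Omega$, $\sum_{z}L(x,z)D(z,y)=\sum_{z}L(y,z)D(x,z)$; in matrix form, $LD=DL^{\mathsf T}$. *)

theory Defs
  imports "HOL-Analysis.Analysis"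
begin

(* The finite set Omega is (the universe of) a type of class finite; matrices indexed by Omega
   and measures on Omega are functions. *)

definition generator :: "('a::finite \<Rightarrow> 'a \<Rightarrow> real) \<Rightarrow> bool" where
  "generator L \<longleftrightarrow> (\<forall>x y. x \<noteq> y \<longrightarrow> L x y \<ge> 0) \<and> (\<forall>x. (\<Sum>y\<in>UNIV. L x y) = 0)"

definition gen_act :: "('a::finite \<Rightarrow> 'a \<Rightarrow> real) \<Rightarrow> ('a \<Rightarrow> real) \<Rightarrow> 'a \<Rightarrow> real" where
  "gen_act L f x = (\<Sum>y\<in>UNIV. L x y * f y)"

(* Irreducibility of the Markov process with generator L: every state is reachable from every
   other one by finitely many jumps of positive rate. *)
definition irreducible_generator :: "('a::finite \<Rightarrow> 'a \<Rightarrow> real) \<Rightarrow> bool" where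
  "irreducible_generator L \<longleftrightarrow> (\<forall>x y. (\<lambda>v w. v \<noteq> w \<and> L v w > 0)\<^sup>*\<^sup>* x y)"

definition reversible :: "('a::finite \<Rightarrow> 'a \<Rightarrow> real) \<Rightarrow> ('a \<Rightarrow> real) \<Rightarrow> bool" where
  "reversible L \<mu> \<longleftrightarrow> (\<forall>x y. \<mu> x * L x y = \<mu> y * L y x)"

definition inner_wrt :: "('a::finite \<Rightarrow> real) \<Rightarrow> ('a \<Rightarrow> real) \<Rightarrow> ('a \<Rightarrow> real) \<Rightarrow> real" where
  "inner_wrt \<mu> f g = (\<Sum>x\<in>UNIV. f x * g x * \<mu> x)"

(* Linear independence is not listed separately, since it follows from orthonormality. *)
definition orthonormal_basis ::
    "('a::finite \<Rightarrow> real) \<Rightarrow> nat set \<Rightarrow> (nat \<Rightarrow> 'a \<Rightarrow> real) \<Rightarrow> bool" where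
  "orthonormal_basis \<mu> I u \<longleftrightarrow>
     (\<forall>i\<in>I. \<forall>j\<in>I. inner_wrt \<mu> (u i) (u j) = (if i = j then 1 else 0)) \<and>
     (\<forall>f. \<exists>c. \<forall>x. f x = (\<Sum>i\<in>I. c i * u i x))"

definition eigenfunction ::
    "('a::finite \<Rightarrow> 'a \<Rightarrow> real) \<Rightarrow> real \<Rightarrow> ('a \<Rightarrow> real) \<Rightarrow> bool" where
  "eigenfunction L l f \<longleftrightarrow> (\<exists>x. f x \<noteq> 0) \<and> (\<forall>x. gen_act L f x = l * f x)"

definition self_duality ::
    "('a::finite \<Rightarrow> 'a \<Rightarrow> real) \<Rightarrow> ('a \<Rightarrow> 'a \<Rightarrow> real) \<Rightarrow> bool" where
  "self_duality L D \<longleftrightarrow> (\<forall>x y. gen_act L (\<lambda>z. D z y) x = gen_act L (\<lambda>z. D x z) y)"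

end

theory Submission
  imports Defs
begin

text \<open>
  Read a function \<open>D\<close> of two variables as a matrix and let \<open>M\<close> be the diagonal matrix of \<open>\<mu>\<close>.
  Self-duality says \<open>L D = D L\<^sup>T\<close>, and reversibility says \<open>L\<^sup>T M = M L\<close>, that is, \<open>L\<close> is
  self-adjoint for the inner product weighted by \<open>\<mu>\<close>. Together they give
  \<open>L (D M) = (D M) L\<close>: the integral operator with kernel \<open>D\<close> commutes with \<open>L\<close>, and therefore
  maps every eigenspace of \<open>L\<close> into itself (\<open>gen_act_duality_transform\<close>). Eigenfunctions for
  different eigenvalues are orthogonal, so in the basis of eigenfunctions the matrix of this
  operator has entries only at pairs with equal eigenvalues; this is the decomposition of \<open>D\<close>,
  and its coefficients are unique because orthonormality lets them be read off from \<open>D\<close>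
  (\<open>tensor_coefficient\<close>).

  The composite \<open>(x, x') \<mapsto> \<langle>D(x, \<cdot>), D'(x', \<cdot>)\<rangle>\<close> is the matrix \<open>D M D'\<^sup>T\<close>. A generator applied
  to its first variable can be passed through \<open>D\<close> to the integration variable, through \<open>M\<close> by
  self-adjointness, and through \<open>D'\<close> to the second variable. A product \<open>f(x) g(y)\<close> is self-dual
  exactly when \<open>Lf(x) g(y) = f(x) Lg(y)\<close>, and for a non-zero product, separating the variables
  makes both \<open>f\<close> and \<open>g\<close> eigenfunctions with a common eigenvalue. Conversely, a product of two
  solutions of the eigenvalue equation for the same eigenvalue is multiplied by that eigenvalue
  whichever variable \<open>L\<close> acts on, which gives the diagonal combinations of eigenfunctions.
\<close>

lemma gen_act_sum:
  "gen_act L (\<lambda>z. \<Sum>i\<in>I. c i * v i z) x = (\<Sum>i\<in>I. c i * gen_act L (v i) x)"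
  unfolding gen_act_def sum_distrib_left
  by (subst sum.swap) (simp add: mult.left_commute)

lemma gen_act_mult_left: "gen_act L (\<lambda>z. c * f z) x = c * gen_act L f x"
  unfolding gen_act_def sum_distrib_left by (simp add: mult.left_commute)

lemma gen_act_mult_right: "gen_act L (\<lambda>z. f z * c) x = gen_act L f x * c"
  unfolding gen_act_def sum_distrib_right by (simp add: mult.assoc)

lemma inner_wrt_sum_left:
  "inner_wrt \<mu> (\<lambda>x. \<Sum>i\<in>I. c i * v i x) g = (\<Sum>i\<in>I. c i * inner_wrt \<mu> (v i) g)"
  unfolding inner_wrt_def sum_distrib_left sum_distrib_right
  by (subst sum.swap) (simp add: mult.assoc)

lemma inner_wrt_mult_left: "inner_wrt \<mu> (\<lambda>x. c * f x) g = c * inner_wrt \<mu> f g"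
  unfolding inner_wrt_def sum_distrib_left by (simp add: mult.assoc)

lemma inner_wrt_mult_right: "inner_wrt \<mu> f (\<lambda>x. c * g x) = c * inner_wrt \<mu> f g"
  unfolding inner_wrt_def sum_distrib_left by (simp add: ac_simps)

lemma gen_act_inner_wrt_left:
  "gen_act L (\<lambda>z. inner_wrt \<mu> (F z) g) x = inner_wrt \<mu> (\<lambda>y. gen_act L (\<lambda>z. F z y) x) g"
  unfolding gen_act_def inner_wrt_def sum_distrib_left sum_distrib_right
  by (subst sum.swap) (simp add: mult.assoc)

lemma gen_act_inner_wrt_right:
  "gen_act L (\<lambda>z. inner_wrt \<mu> g (F z)) x = inner_wrt \<mu> g (\<lambda>y. gen_act L (\<lambda>z. F z y) x)"
  unfolding gen_act_def inner_wrt_def sum_distrib_left sum_distrib_right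
  by (subst sum.swap) (simp add: ac_simps)

text \<open>Both sides are double sums over pairs of states, and detailed balance matches the
  \<open>(x, y)\<close> term of one with the \<open>(y, x)\<close> term of the other.\<close>

lemma gen_act_selfadjoint:
  assumes "reversible L \<mu>"
  shows "inner_wrt \<mu> (gen_act L f) g = inner_wrt \<mu> f (gen_act L g)"
proof -
  have balance: "L x y * \<mu> x = L y x * \<mu> y" for x y
    using assms unfolding reversible_def by (simp add: mult.commute)
  have "inner_wrt \<mu> (gen_act L f) g = (\<Sum>x\<in>UNIV. \<Sum>y\<in>UNIV. (L x y * \<mu> x) * (f y * g x))"
    unfolding inner_wrt_def gen_act_def sum_distrib_right by (simp add: ac_simps)
  also have "\<dots> = (\<Sum>y\<in>UNIV. \<Sum>x\<in>UNIV. (L y x * \<mu> y) * (f y * g x))"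
    by (subst sum.swap, intro sum.cong refl) (simp add: balance)
  also have "\<dots> = inner_wrt \<mu> f (gen_act L g)"
    unfolding inner_wrt_def gen_act_def sum_distrib_right sum_distrib_left
    by (simp add: ac_simps)
  finally show ?thesis .
qed

lemma eigenfunctions_orthogonal:
  assumes "reversible L \<mu>"
    and "\<And>x. gen_act L f x = l * f x" and "\<And>x. gen_act L g x = m * g x" and "l \<noteq> m"
  shows "inner_wrt \<mu> f g = 0"
proof -
  have "gen_act L f = (\<lambda>x. l * f x)" "gen_act L g = (\<lambda>x. m * g x)"
    using assms by auto
  then have "l * inner_wrt \<mu> f g = m * inner_wrt \<mu> f g"
    using gen_act_selfadjoint[OF assms(1), of f g]
    by (simp add: inner_wrt_mult_left inner_wrt_mult_right)
  with \<open>l \<noteq> m\<close> show ?thesis by simp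
qed

lemma orthonormal_basis_expansion:
  assumes "finite I" and "orthonormal_basis \<mu> I u"
  shows "f x = (\<Sum>i\<in>I. inner_wrt \<mu> f (u i) * u i x)"
proof -
  from assms(2) obtain c where c: "f = (\<lambda>x. \<Sum>i\<in>I. c i * u i x)"
    unfolding orthonormal_basis_def by fastforce
  have "inner_wrt \<mu> f (u j) = c j" if "j \<in> I" for j
  proof -
    have "inner_wrt \<mu> f (u j) = (\<Sum>i\<in>I. c i * inner_wrt \<mu> (u i) (u j))"
      unfolding c by (rule inner_wrt_sum_left)
    also have "\<dots> = (\<Sum>i\<in>I. if i = j then c i else 0)"
      using assms(2) that unfolding orthonormal_basis_def by (intro sum.cong) auto
    also have "\<dots> = c j" using that assms(1) by simp
    finally show ?thesis .
  qed
  then show ?thesis by (subst c) simp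
qed

text \<open>The integral operator with kernel \<open>D\<close> commutes with \<open>L\<close>: self-duality moves \<open>L\<close> from the
  outer to the integration variable, and self-adjointness moves it on to the argument.\<close>

lemma gen_act_duality_transform:
  assumes "reversible L \<mu>" and "self_duality L D"
  shows "gen_act L (\<lambda>z. inner_wrt \<mu> (D z) g) x = inner_wrt \<mu> (D x) (gen_act L g)"
proof -
  have "gen_act L (\<lambda>z. inner_wrt \<mu> (D z) g) x = inner_wrt \<mu> (gen_act L (D x)) g"
    using assms(2) unfolding gen_act_inner_wrt_left self_duality_def by simp
  also have "\<dots> = inner_wrt \<mu> (D x) (gen_act L g)"
    by (rule gen_act_selfadjoint[OF assms(1)])
  finally show ?thesis .
qed

lemma self_duality_diagonal:
  assumes "\<And>i x. i \<in> I \<Longrightarrow> gen_act L (u i) x = lam i * u i x"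
  shows "self_duality L (\<lambda>x y. \<Sum>i\<in>I. a i * u i x * u i y)"
proof -
  have "gen_act L (\<lambda>z. \<Sum>i\<in>I. a i * u i z * u i y) x = (\<Sum>i\<in>I. a i * lam i * u i x * u i y)"
    for x y
  proof -
    have "gen_act L (\<lambda>z. \<Sum>i\<in>I. a i * u i z * u i y) x
        = gen_act L (\<lambda>z. \<Sum>i\<in>I. (a i * u i y) * u i z) x"
      by (simp add: ac_simps)
    also have "\<dots> = (\<Sum>i\<in>I. a i * lam i * u i x * u i y)"
      unfolding gen_act_sum by (intro sum.cong) (simp_all add: assms)
    finally show ?thesis .
  qed
  moreover have "gen_act L (\<lambda>z. \<Sum>i\<in>I. a i * u i x * u i z) y
      = (\<Sum>i\<in>I. a i * lam i * u i x * u i y)" for x y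
    unfolding gen_act_sum by (intro sum.cong) (simp_all add: assms)
  ultimately show ?thesis unfolding self_duality_def by simp
qed

text \<open>The products \<open>u i \<otimes> u j\<close> are orthonormal for the product measure, so pairing a
  combination of them with \<open>u p \<otimes> u q\<close> isolates one coefficient.\<close>

lemma tensor_coefficient:
  assumes "orthonormal_basis \<mu> I u" and "finite I" and "S \<subseteq> I \<times> I" and "(p, q) \<in> S"
    and D: "\<And>x y. D x y = (\<Sum>(i, j)\<in>S. a (i, j) * u i x * u j y)"
  shows "inner_wrt \<mu> (\<lambda>x. inner_wrt \<mu> (D x) (u q)) (u p) = a (p, q)"
proof -
  have fin: "finite S" using assms(2,3) finite_subset by blast
  have on: "inner_wrt \<mu> (u i) (u j) = (if i = j then 1 else 0)" if "i \<in> I" "j \<in> I" for i j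
    using assms(1) that unfolding orthonormal_basis_def by blast
  have D': "D x = (\<lambda>y. \<Sum>s\<in>S. (a s * u (fst s) x) * u (snd s) y)" for x
    using D by (auto simp: case_prod_unfold)
  have "inner_wrt \<mu> (D x) (u q)
      = (\<Sum>s\<in>S. (a s * inner_wrt \<mu> (u (snd s)) (u q)) * u (fst s) x)" for x
    unfolding D' inner_wrt_sum_left by (simp add: ac_simps)
  then have "inner_wrt \<mu> (\<lambda>x. inner_wrt \<mu> (D x) (u q)) (u p)
      = (\<Sum>s\<in>S. a s * inner_wrt \<mu> (u (snd s)) (u q) * inner_wrt \<mu> (u (fst s)) (u p))"
    by (simp add: inner_wrt_sum_left)
  also have "\<dots> = (\<Sum>s\<in>S. if s = (p, q) then a s else 0)"
    using assms(3,4) by (intro sum.cong) (auto simp: on subset_iff split: if_splits)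
  also have "\<dots> = a (p, q)" using fin assms(4) by simp
  finally show ?thesis .
qed

text \<open>Expanding \<open>D\<close> in both variables gives coefficients for all pairs of indices. The integral
  operator sends \<open>u j\<close> to a solution of the eigenvalue equation for \<open>lam j\<close>, which is orthogonal
  to \<open>u i\<close> unless \<open>lam i = lam j\<close>, so the other coefficients vanish.\<close>

lemma self_duality_expansion:
  assumes "finite I" and "orthonormal_basis \<mu> I u" and "reversible L \<mu>" and "self_duality L D"
    and eig: "\<And>i x. i \<in> I \<Longrightarrow> gen_act L (u i) x = lam i * u i x"
  shows "D x y = (\<Sum>(i, j)\<in>{(i, j). i \<in> I \<and> j \<in> I \<and> lam i = lam j}.
      inner_wrt \<mu> (\<lambda>x. inner_wrt \<mu> (D x) (u j)) (u i) * u i x * u j y)"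
proof -
  define b where "b i j = inner_wrt \<mu> (\<lambda>x. inner_wrt \<mu> (D x) (u j)) (u i)" for i j
  have vanish: "b i j = 0" if "i \<in> I" "j \<in> I" "lam i \<noteq> lam j" for i j
    unfolding b_def
  proof (rule eigenfunctions_orthogonal[OF assms(3)])
    have "gen_act L (u j) = (\<lambda>x. lam j * u j x)" using eig[OF \<open>j \<in> I\<close>] by auto
    then show "gen_act L (\<lambda>x. inner_wrt \<mu> (D x) (u j)) z = lam j * inner_wrt \<mu> (D z) (u j)" for z
      by (simp add: gen_act_duality_transform[OF assms(3,4)] inner_wrt_mult_right)
    show "gen_act L (u i) z = lam i * u i z" for z using eig[OF \<open>i \<in> I\<close>] .
    show "lam j \<noteq> lam i" using that(3) by simp
  qed
  have "D x y = (\<Sum>j\<in>I. inner_wrt \<mu> (D x) (u j) * u j y)"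
    by (rule orthonormal_basis_expansion[OF assms(1,2)])
  also have "\<dots> = (\<Sum>j\<in>I. (\<Sum>i\<in>I. b i j * u i x) * u j y)"
    unfolding b_def
    using orthonormal_basis_expansion[OF assms(1,2), of "\<lambda>x. inner_wrt \<mu> (D x) (u _)" x]
    by simp
  also have "\<dots> = (\<Sum>(i, j)\<in>I \<times> I. b i j * u i x * u j y)"
    unfolding sum_distrib_right by (subst sum.swap) (simp add: sum.cartesian_product)
  also have "\<dots> = (\<Sum>(i, j)\<in>{(i, j). i \<in> I \<and> j \<in> I \<and> lam i = lam j}. b i j * u i x * u j y)"
    using assms(1) by (intro sum.mono_neutral_right) (auto dest: vanish)
  finally show ?thesis unfolding b_def .
qed

lemma self_duality_unique_expansion:
  assumes "finite I" and "orthonormal_basis \<mu> I u" and "reversible L \<mu>" and "self_duality L D"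
    and eig: "\<And>i x. i \<in> I \<Longrightarrow> gen_act L (u i) x = lam i * u i x"
  defines "S \<equiv> {(i, j). i \<in> I \<and> j \<in> I \<and> lam i = lam j}"
  shows "\<exists>!a. a \<in> extensional S \<and> (\<forall>x y. D x y = (\<Sum>(i, j)\<in>S. a (i, j) * u i x * u j y))"
proof -
  define b where "b = restrict (\<lambda>(i, j). inner_wrt \<mu> (\<lambda>x. inner_wrt \<mu> (D x) (u j)) (u i)) S"
  have S: "S \<subseteq> I \<times> I" unfolding S_def by auto
  show ?thesis
  proof (rule ex1I[of _ b])
    have "D x y = (\<Sum>(i, j)\<in>S. b (i, j) * u i x * u j y)" for x y
    proof -
      have "D x y = (\<Sum>(i, j)\<in>S. inner_wrt \<mu> (\<lambda>x. inner_wrt \<mu> (D x) (u j)) (u i) * u i x * u j y)"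
        unfolding S_def by (rule self_duality_expansion[OF assms(1-4) eig])
      also have "\<dots> = (\<Sum>(i, j)\<in>S. b (i, j) * u i x * u j y)"
        unfolding b_def by (intro sum.cong) auto
      finally show ?thesis .
    qed
    then show "b \<in> extensional S \<and> (\<forall>x y. D x y = (\<Sum>(i, j)\<in>S. b (i, j) * u i x * u j y))"
      unfolding b_def by simp
  next
    fix a
    assume a: "a \<in> extensional S \<and> (\<forall>x y. D x y = (\<Sum>(i, j)\<in>S. a (i, j) * u i x * u j y))"
    show "a = b"
    proof (rule extensionalityI[of _ S])
      show "a \<in> extensional S" using a by blast
      show "b \<in> extensional S" unfolding b_def by simp
      fix s assume "s \<in> S"
      then show "a s = b s"
        using tensor_coefficient[OF assms(2,1) S, of "fst s" "snd s" D a] a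
        unfolding b_def by (simp add: case_prod_unfold)
    qed
  qed
qed

lemma self_duality_product_eigenfunctions:
  assumes "self_duality L (\<lambda>x y. f x * g y)" and "f x0 * g y0 \<noteq> 0"
  shows "\<exists>l. eigenfunction L l f \<and> eigenfunction L l g"
proof -
  have sep: "gen_act L f x * g y = f x * gen_act L g y" for x y
    using assms(1) unfolding self_duality_def
    by (simp add: gen_act_mult_left gen_act_mult_right)
  have nz: "f x0 \<noteq> 0" "g y0 \<noteq> 0" using assms(2) by auto
  define l where "l = gen_act L g y0 / g y0"
  have f: "gen_act L f x = l * f x" for x
    using sep[of x y0] nz unfolding l_def by (simp add: field_simps)
  have "gen_act L g y = l * g y" for y
    using sep[of x0 y] nz by (simp add: f)
  with f nz show ?thesis unfolding eigenfunction_def by blast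
qed

text \<open>Viewed as a function of \<open>x\<close>, the composite is the integral operator of \<open>D\<close> applied to
  \<open>D' x'\<close>. Commuting \<open>L\<close> with that operator leaves \<open>L\<close> acting on the second variable of \<open>D'\<close>,
  whose self-duality turns this into an action on \<open>x'\<close>.\<close>

lemma self_duality_inner_wrt:
  assumes "reversible L \<mu>" and "self_duality L D" and "self_duality L D'"
  shows "self_duality L (\<lambda>x x'. inner_wrt \<mu> (D x) (D' x'))"
  unfolding self_duality_def
proof (intro allI)
  fix x x'
  have "gen_act L (\<lambda>z. inner_wrt \<mu> (D z) (D' x')) x = inner_wrt \<mu> (D x) (gen_act L (D' x'))"
    by (rule gen_act_duality_transform[OF assms(1,2)])
  also have "\<dots> = gen_act L (\<lambda>z. inner_wrt \<mu> (D x) (D' z)) x'"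
    using assms(3) unfolding gen_act_inner_wrt_right self_duality_def by simp
  finally show "gen_act L (\<lambda>z. inner_wrt \<mu> (D z) (D' x')) x
      = gen_act L (\<lambda>z. inner_wrt \<mu> (D x) (D' z)) x'" .
qed

theorem proposition3p1:
  fixes L :: "'a::finite \<Rightarrow> 'a \<Rightarrow> real"
    and \<mu> :: "'a \<Rightarrow> real"
    and n :: nat
    and u :: "nat \<Rightarrow> 'a \<Rightarrow> real"
    and lam :: "nat \<Rightarrow> real"
  assumes "CARD('a) = n"
    and "generator L"
    and "irreducible_generator L"
    and "\<And>x. \<mu> x > 0"
    and "reversible L \<mu>"
    and "orthonormal_basis \<mu> {1..n} u"
    and "\<And>i. i \<in> {1..n} \<Longrightarrow> eigenfunction L (lam i) (u i)"
    and "lam 1 = 0"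
    and "2 \<le> n \<Longrightarrow> lam 1 > lam 2"
    and "\<And>i j. 2 \<le> i \<Longrightarrow> i \<le> j \<Longrightarrow> j \<le> n \<Longrightarrow> lam i \<ge> lam j"
    and "\<exists>c. \<forall>x. u 1 x = c"
  shows
    "(\<forall>a :: nat \<Rightarrow> real. self_duality L (\<lambda>x y. \<Sum>i=1..n. a i * u i x * u i y)) \<and>
     (\<forall>D. self_duality L D \<longrightarrow>
        (\<exists>!a :: nat \<times> nat \<Rightarrow> real.
           a \<in> extensional {(i, j). i \<in> {1..n} \<and> j \<in> {1..n} \<and> lam i = lam j} \<and>
           (\<forall>x y. D x y =
              (\<Sum>(i, j) \<in> {(i, j). i \<in> {1..n} \<and> j \<in> {1..n} \<and> lam i = lam j}.
                 a (i, j) * u i x * u j y)))) \<and>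
     (\<forall>f g. self_duality L (\<lambda>x y. f x * g y) \<and> (\<exists>x y. f x * g y \<noteq> 0) \<longrightarrow>
        (\<exists>l. eigenfunction L l f \<and> eigenfunction L l g)) \<and>
     (\<forall>D D'. self_duality L D \<and> self_duality L D' \<longrightarrow>
        self_duality L (\<lambda>x x'. inner_wrt \<mu> (D x) (D' x')))"
proof (intro conjI allI impI)
  have eig: "gen_act L (u i) x = lam i * u i x" if "i \<in> {1..n}" for i x
    using assms(7)[OF that] unfolding eigenfunction_def by blast
  show "self_duality L (\<lambda>x y. \<Sum>i=1..n. a i * u i x * u i y)" for a
    by (rule self_duality_diagonal[OF eig])
  show "\<exists>!a :: nat \<times> nat \<Rightarrow> real.
      a \<in> extensional {(i, j). i \<in> {1..n} \<and> j \<in> {1..n} \<and> lam i = lam j} \<and>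
      (\<forall>x y. D x y =
        (\<Sum>(i, j) \<in> {(i, j). i \<in> {1..n} \<and> j \<in> {1..n} \<and> lam i = lam j}.
          a (i, j) * u i x * u j y))"
    if "self_duality L D" for D
    by (rule self_duality_unique_expansion[OF _ assms(6,5) that eig]) simp_all
  show "\<exists>l. eigenfunction L l f \<and> eigenfunction L l g"
    if "self_duality L (\<lambda>x y. f x * g y) \<and> (\<exists>x y. f x * g y \<noteq> 0)" for f g
    using that self_duality_product_eigenfunctions by blast
  show "self_duality L (\<lambda>x x'. inner_wrt \<mu> (D x) (D' x'))"
    if "self_duality L D \<and> self_duality L D'" for D D'
    using that self_duality_inner_wrt[OF assms(5)] by blast
qed

end
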